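(* Let $\mu>0$ and let $z\in\mathbb{C}$ with $|z|\leq 1$ and $z\neq 1$. Then, as $r\uparrow\infty$, the function $F_\mu(r,z)=\sum_{n=1}^\infty \frac{2n z^n}{(n^2+r^2)^{\mu+1}}$ has the asymptotic expansion $$F_{\mu}(r,z) \sim \sum_{k=0}^\infty r^{-2k-2\mu-2}\, \frac{2(-1)^{k}\,\Gamma(k+\mu+1)}{k!\,\Gamma(\mu+1)}\,\mathrm{Li}_{-2k-1}(z) = 2\sum_{k=0}^\infty r^{-2k-2\mu-2} (-1)^{k}\binom{k+\mu}{k}\mathrm{Li}_{-2k-1}(z).$$
   Context: For $r>0$, $\mu>0$ and $z\in\mathbb{C}$ with $|z|\le 1$, put $F_{\mu}(r,z) := \sum_{n=1}^\infty \frac{2n z^n}{(n^2+r^2)^{\mu+1}}$. The polylogarithm is $\mathrm{Li}_\alpha(z)=\sum_{n=1}^\infty \frac{z^n}{n^\alpha}$ for $|z|<1$, $\alpha\in\mathbb{C}$. It is continued analytically in $z$ to $\mathbb{C}\setminus[1,\infty)$, for instance by the Lindelöf integral $\mathrm{Li}_\alpha(z) = -\frac{1}{2\pi i}\int_{1/2-i\infty}^{1/2+i\infty}\frac{(-z)^u}{u^\alpha}\frac{\pi}{\sin \pi u}\,du$ (principal branches) for $z\in\mathbb{C}\setminus[0,\infty)$. For each fixed $z\in\mathbb{C}\setminus[1,\infty)$, it is an entire function of $\alpha$. The symbol $\sim$ followed by an infinite series denotes an asymptotic expansion in the sense of Poincaré (the series is formal and need not converge): for every $K\in\mathbb{N}_0$,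 the difference between $F_\mu(r,z)$ and the sum of the terms with $k<K$ is $O(r^{-2K-2\mu-2})$ as $r\uparrow\infty$, with $\mu,z$ fixed. The equality between the two series is termwise, with $\binom{k+\mu}{k}=\frac{\Gamma(k+\mu+1)}{k!\,\Gamma(\mu+1)}$. *)

theory Defs
  imports "HOL-Complex_Analysis.Complex_Analysis" "HOL-Library.Landau_Symbols"
begin

definition slit_plane :: "complex set" where
  "slit_plane = - (complex_of_real ` {1..})"

text \<open>
  The polylogarithm is the analytic continuation in \<open>z\<close> of the series
  \<open>\<Sum>n\<ge>1. z^n / n^\<alpha>\<close> from the open unit disc to the plane cut along \<open>[1, \<infinity>)\<close>.
  The continuation is unique (lemma \<open>polylog_eqI\<close>); on the cut the value is unspecified.
\<close>

definition polylog :: "complex \<Rightarrow> complex \<Rightarrow> complex" where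
  "polylog \<alpha> z =
     (THE w. \<exists>f. f holomorphic_on slit_plane \<and>
        (\<forall>x. norm x < 1 \<longrightarrow> (\<lambda>n. x ^ Suc n / of_nat (Suc n) powr \<alpha>) sums f x) \<and>
        w = f z)"

definition F_sum :: "real \<Rightarrow> real \<Rightarrow> complex \<Rightarrow> complex" where
  "F_sum \<mu> r z =
     (\<Sum>n. 2 * of_nat (Suc n) * z ^ Suc n / of_real (((real (Suc n))\<^sup>2 + r\<^sup>2) powr (\<mu> + 1)))"

text \<open>
  Poincare asymptotic expansion of \<open>f\<close> along the filter \<open>G\<close>: \<open>t k\<close> is the \<open>k\<close>-th term of the
  (formal) series and \<open>\<phi> K\<close> the required order of the remainder after the terms with \<open>k < K\<close>.
\<close>

definition has_asymptotic_expansion ::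
  "('a \<Rightarrow> complex) \<Rightarrow> (nat \<Rightarrow> 'a \<Rightarrow> complex) \<Rightarrow> (nat \<Rightarrow> 'a \<Rightarrow> real) \<Rightarrow> 'a filter \<Rightarrow> bool" where
  "has_asymptotic_expansion f t \<phi> G \<longleftrightarrow>
     (\<forall>K. (\<lambda>x. f x - (\<Sum>k<K. t k x)) \<in> O[G](\<lambda>x. of_real (\<phi> K x)))"

lemma open_slit_plane: "open slit_plane"
proof -
  have "closed (complex_of_real ` {1..})"
    by (rule closed_injective_linear_image)
       (auto intro!: bounded_linear.linear bounded_linear_of_real simp: inj_def)
  thus ?thesis by (simp add: slit_plane_def open_Compl)
qed

lemma ball_subset_slit_plane: "ball 0 1 \<subseteq> slit_plane"
  by (auto simp: slit_plane_def)

lemma connected_slit_plane: "connected slit_plane"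
proof (rule starlike_imp_connected, unfold starlike_def, intro bexI ballI subsetI)
  show "0 \<in> slit_plane" using ball_subset_slit_plane by auto
next
  fix z w assume z: "z \<in> slit_plane" and "w \<in> closed_segment 0 z"
  then obtain t where t: "0 \<le> t" "t \<le> 1" "w = of_real t * z"
    by (auto simp: in_segment scaleR_conv_of_real)
  show "w \<in> slit_plane"
  proof (rule ccontr)
    assume "w \<notin> slit_plane"
    then obtain s where s: "s \<ge> 1" "w = of_real s"
      by (auto simp: slit_plane_def)
    with t have "t \<noteq> 0" by auto
    with s t have "z = of_real (s / t)" "s / t \<ge> 1"
      by (auto simp: field_simps)
    hence "z \<in> complex_of_real ` {1..}" by blast
    with z show False by (simp add: slit_plane_def)
  qed
qed

lemma polylog_eqI:
  assumes hol: "f holomorphic_on slit_plane"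
    and sums: "\<And>x. norm x < 1 \<Longrightarrow> (\<lambda>n. x ^ Suc n / of_nat (Suc n) powr \<alpha>) sums f x"
    and z: "z \<in> slit_plane"
  shows "polylog \<alpha> z = f z"
  unfolding polylog_def
proof (rule the_equality)
  fix w assume "\<exists>g. g holomorphic_on slit_plane \<and>
        (\<forall>x. norm x < 1 \<longrightarrow> (\<lambda>n. x ^ Suc n / of_nat (Suc n) powr \<alpha>) sums g x) \<and> w = g z"
  then obtain g where g: "g holomorphic_on slit_plane" "w = g z"
      "\<And>x. norm x < 1 \<Longrightarrow> (\<lambda>n. x ^ Suc n / of_nat (Suc n) powr \<alpha>) sums g x"
    by blast
  have "g z = f z"
  proof (rule analytic_continuation_open[of "ball 0 1" slit_plane g f])
    show "g x = f x" if "x \<in> ball 0 1" for x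
      using that sums_unique2[OF g(3) sums] by simp
  qed (use ball_subset_slit_plane open_slit_plane connected_slit_plane hol g z in auto)
  with g show "w = f z" by simp
qed (use assms in blast)

end

theory Submission
  imports Defs
begin

text \<open>
  Let \<open>a\<^sub>r(x) = x (x\<^sup>2 + r\<^sup>2) powr (-\<mu>-1)\<close>, so that \<open>F_sum \<mu> r z = 2 (\<Sum>n. a\<^sub>r(n) z ^ n)\<close>.  Summing by parts
  \<open>M\<close> times (Euler's transformation) gives, for \<open>z \<noteq> 1\<close>,
  \<open>(\<Sum>n. a(n) z ^ n) = (\<Sum>j<M. \<Delta>\<^sup>j a(0) z ^ j / (1 - z) ^ (j + 1)) + (z / (1 - z)) ^ M (\<Sum>n. \<Delta>\<^sup>M a(n) z ^ n)\<close>.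
  For \<open>a(x) = x ^ (2k+1)\<close> and \<open>M > 2k+1\<close> the tail vanishes, and the finite sum, being rational in \<open>z\<close>
  with its only pole at 1, is \<open>Li\<close> of order \<open>-2k-1\<close> on the whole slit plane.  For \<open>a\<^sub>r\<close> the finite sum involves
  only the values of \<open>a\<^sub>r\<close> at \<open>0, \<dots>, M - 1\<close>, where the binomial series in \<open>x\<^sup>2 / r\<^sup>2\<close> applies
  pointwise, so no uniformity in \<open>n\<close> is needed there.  The tail is small because every
  difference of \<open>a\<^sub>r\<close> lowers its degree of homogeneity in \<open>(x, r)\<close> by one.
\<close>

section \<open>Forward differences of real functions\<close>

definition fdiff :: "(real \<Rightarrow> real) \<Rightarrow> real \<Rightarrow> real" where
  "fdiff f x = f (x + 1) - f x"

lemma fdiff_pow_add: "(fdiff ^^ M) (\<lambda>x. f x + g x) x = (fdiff ^^ M) f x + (fdiff ^^ M) g x"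
  by (induction M arbitrary: x) (simp_all add: fdiff_def)

lemma fdiff_pow_cmult: "(fdiff ^^ M) (\<lambda>x. c * f x) x = c * (fdiff ^^ M) f x"
  by (induction M arbitrary: x) (simp_all add: fdiff_def algebra_simps)

lemma fdiff_pow_diff: "(fdiff ^^ M) (\<lambda>x. f x - g x) x = (fdiff ^^ M) f x - (fdiff ^^ M) g x"
  by (induction M arbitrary: x) (simp_all add: fdiff_def)

lemma fdiff_pow_zero: "(fdiff ^^ M) (\<lambda>x. 0) x = 0"
  by (induction M arbitrary: x) (simp_all add: fdiff_def)

lemma fdiff_pow_sum:
  "finite A \<Longrightarrow> (fdiff ^^ M) (\<lambda>x. \<Sum>i\<in>A. f i x) x = (\<Sum>i\<in>A. (fdiff ^^ M) (f i) x)"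
  by (induction A rule: finite_induct) (simp_all add: fdiff_pow_zero fdiff_pow_add)

lemma fdiff_pow_has_derivative:
  assumes "\<And>x. (f has_field_derivative f' x) (at x)"
  shows "((fdiff ^^ M) f has_field_derivative (fdiff ^^ M) f' x) (at x)"
proof (induction M arbitrary: x)
  case (Suc M)
  have "((\<lambda>x. (fdiff ^^ M) f (x + 1)) has_field_derivative (fdiff ^^ M) f' (x + 1)) (at x)"
    using Suc[of "x + 1"] by (simp only: DERIV_shift)
  from DERIV_diff[OF this Suc[of x]] show ?case
    by (simp add: fdiff_def[abs_def])
qed (use assms in simp)

text \<open>Differencing commutes with differentiation, so the mean value theorem can trade the
  outermost difference for a derivative and leave the other \<open>M\<close> in place. This drives
  the inductions for powers and for \<open>quad_monom\<close>.\<close>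

lemma fdiff_pow_MVT:
  assumes "\<And>x. (f has_field_derivative f' x) (at x)"
  obtains \<xi> where "x < \<xi>" "\<xi> < x + 1" "(fdiff ^^ Suc M) f x = (fdiff ^^ M) f' \<xi>"
proof -
  from MVT2[of x "x + 1" "(fdiff ^^ M) f" "(fdiff ^^ M) f'"] fdiff_pow_has_derivative[OF assms]
  obtain \<xi> where "x < \<xi>" "\<xi> < x + 1" "(fdiff ^^ M) f (x + 1) - (fdiff ^^ M) f x = (fdiff ^^ M) f' \<xi>"
    by auto
  with that show ?thesis by (simp add: fdiff_def)
qed

text \<open>Trading a difference for a derivative lowers order and degree together, so the order
  stays above the degree until a constant is differentiated.\<close>

lemma fdiff_pow_power_eq_0:
  "i < M \<Longrightarrow> (fdiff ^^ M) (\<lambda>x. x ^ i) x = 0"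
proof (induction M arbitrary: i x)
  case (Suc M)
  have "((\<lambda>x. x ^ i) has_field_derivative real i * x ^ (i - 1)) (at x)" for x :: real
    by (auto intro!: derivative_eq_intros)
  from fdiff_pow_MVT[OF this] obtain \<xi> where
    "(fdiff ^^ Suc M) (\<lambda>x. x ^ i) x = (fdiff ^^ M) (\<lambda>x. real i * x ^ (i - 1)) \<xi>" by metis
  also have "\<dots> = 0"
    using Suc by (cases "i = 0") (auto simp: fdiff_pow_cmult fdiff_pow_zero)
  finally show ?case .
qed auto

section \<open>Decay of the differences of the summand\<close>

text \<open>The function \<open>a\<^sub>r\<close> is the case \<open>i = 1\<close>,
  \<open>s = - \<mu> - 1\<close>. The larger family is closed under differentiation in
  \<open>x\<close> up to linear combinations; each member is homogeneous of degree
  \<open>i + 2 * s\<close> in \<open>(x, r)\<close>.\<close>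

definition quad_monom :: "nat \<Rightarrow> real \<Rightarrow> real \<Rightarrow> real \<Rightarrow> real" where
  "quad_monom i s r x = x ^ i * (x\<^sup>2 + r\<^sup>2) powr s"

lemma quad_monom_has_derivative:
  assumes "r > 0"
  shows "(quad_monom i s r has_field_derivative
           real i * quad_monom (i - 1) s r x + 2 * s * quad_monom (i + 1) (s - 1) r x) (at x)"
proof -
  have pos: "x\<^sup>2 + r\<^sup>2 > 0" using assms by (simp add: add_nonneg_pos)
  show ?thesis
    unfolding quad_monom_def[abs_def] using pos
    by (auto intro!: derivative_eq_intros simp: algebra_simps powr_diff)
qed

lemma abs_quad_monom_le:
  assumes "r > 0"
  shows "\<bar>quad_monom i s r x\<bar> \<le> (x\<^sup>2 + r\<^sup>2) powr ((real i + 2 * s) / 2)"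
proof -
  have pos: "x\<^sup>2 + r\<^sup>2 > 0" using assms by (simp add: add_nonneg_pos)
  have "\<bar>x\<bar> = sqrt (x\<^sup>2)" by simp
  also have "\<dots> \<le> sqrt (x\<^sup>2 + r\<^sup>2)" by (intro real_sqrt_le_mono) simp
  finally have "\<bar>x\<bar> ^ i \<le> sqrt (x\<^sup>2 + r\<^sup>2) ^ i" by (intro power_mono) auto
  also have "\<dots> = ((x\<^sup>2 + r\<^sup>2) powr (1 / 2)) powr real i"
    using pos by (simp add: powr_half_sqrt powr_realpow)
  also have "\<dots> = (x\<^sup>2 + r\<^sup>2) powr (real i / 2)"
    by (simp add: powr_powr)
  finally have "\<bar>x\<bar> ^ i * (x\<^sup>2 + r\<^sup>2) powr s \<le> (x\<^sup>2 + r\<^sup>2) powr (real i / 2) * (x\<^sup>2 + r\<^sup>2) powr s"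
    by (intro mult_right_mono) auto
  thus ?thesis
    by (simp add: quad_monom_def abs_mult power_abs powr_add [symmetric] add_divide_distrib)
qed

text \<open>Both terms of the derivative have degree one lower but different \<open>i\<close> and
  \<open>s\<close>, so the induction on \<open>M\<close> ranges over all \<open>i\<close> and
  \<open>s\<close>. \<open>C\<close> depends on neither \<open>r\<close> nor \<open>x\<close>, which
  later allows summation over \<open>n\<close> with control in \<open>r\<close>.\<close>

lemma fdiff_pow_quad_monom_bound:
  assumes "real i + 2 * s \<le> 0"
  obtains C where "C \<ge> 0"
    "\<And>r x. r > 0 \<Longrightarrow> x \<ge> 0 \<Longrightarrow>
       \<bar>(fdiff ^^ M) (quad_monom i s r) x\<bar> \<le> C * (x\<^sup>2 + r\<^sup>2) powr ((real i + 2 * s - real M) / 2)"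
proof -
  have "\<exists>C\<ge>0. \<forall>r>0. \<forall>x\<ge>0. \<bar>(fdiff ^^ M) (quad_monom i s r) x\<bar>
            \<le> C * (x\<^sup>2 + r\<^sup>2) powr ((real i + 2 * s - real M) / 2)"
    using assms
  proof (induction M arbitrary: i s)
    case 0
    show ?case using abs_quad_monom_le by (intro exI[of _ 1]) auto
  next
    case (Suc M)
    define e where "e = (real i + 2 * s - real (Suc M)) / 2"
    have e: "e \<le> 0" using Suc.prems by (simp add: e_def)
    obtain B where B: "B \<ge> 0" "\<And>r x. r > 0 \<Longrightarrow> x \<ge> 0 \<Longrightarrow> 
        \<bar>(fdiff ^^ M) (quad_monom (i + 1) (s - 1) r) x\<bar> \<le> B * (x\<^sup>2 + r\<^sup>2) powr e"
      using Suc.IH[of "i + 1" "s - 1"] Suc.prems by (auto simp: e_def algebra_simps)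
    obtain A where A: "A \<ge> 0" "\<And>r x. r > 0 \<Longrightarrow> x \<ge> 0 \<Longrightarrow> 
        \<bar>real i * (fdiff ^^ M) (quad_monom (i - 1) s r) x\<bar> \<le> A * (x\<^sup>2 + r\<^sup>2) powr e"
    \<comment> \<open>At \<open>i = 0\<close> the truncated index \<open>i - 1\<close> would not
      lower the degree, but the coefficient \<open>real i\<close> vanishes and \<open>A = 0\<close>
      works.\<close>
    proof (cases "i = 0")
      case False
      then have i: "real (i - 1) + 2 * s - real M = real i + 2 * s - real (Suc M)"
        "real (i - 1) + 2 * s \<le> 0" using Suc.prems by linarith+
      obtain A where "A \<ge> 0" "\<And>r x. r > 0 \<Longrightarrow> x \<ge> 0 \<Longrightarrow> 
        \<bar>(fdiff ^^ M) (quad_monom (i - 1) s r) x\<bar> \<le> A * (x\<^sup>2 + r\<^sup>2) powr e"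
        using Suc.IH[OF i(2)] unfolding i(1) by (auto simp: e_def)
      then show ?thesis
        by (intro that[of "real i * A"]) (auto simp: abs_mult mult.assoc intro!: mult_left_mono)
    qed (use that[of 0] in auto)
    have "\<bar>(fdiff ^^ Suc M) (quad_monom i s r) x\<bar> \<le> (A + 2 * \<bar>s\<bar> * B) * (x\<^sup>2 + r\<^sup>2) powr e"
      if r: "r > 0" and x: "x \<ge> 0" for r x
    proof -
      from fdiff_pow_MVT[OF quad_monom_has_derivative[OF r]] obtain \<xi> where \<xi>: "x < \<xi>"
        "(fdiff ^^ Suc M) (quad_monom i s r) x = 
          (fdiff ^^ M) (\<lambda>x. real i * quad_monom (i - 1) s r x 
              + 2 * s * quad_monom (i + 1) (s - 1) r x) \<xi>"
        by metis
      have "\<bar>(fdiff ^^ Suc M) (quad_monom i s r) x\<bar> \<le>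
              \<bar>real i * (fdiff ^^ M) (quad_monom (i - 1) s r) \<xi>\<bar> + 
              2 * \<bar>s\<bar> * \<bar>(fdiff ^^ M) (quad_monom (i + 1) (s - 1) r) \<xi>\<bar>"
        unfolding \<xi> fdiff_pow_add fdiff_pow_cmult
        by (rule order_trans[OF abs_triangle_ineq]) (simp add: abs_mult)
      also have "\<dots> \<le> A * (\<xi>\<^sup>2 + r\<^sup>2) powr e + 2 * \<bar>s\<bar> * (B * (\<xi>\<^sup>2 + r\<^sup>2) powr e)"
        using r x \<xi> by (intro add_mono mult_left_mono A B) auto
      also have "\<dots> = (A + 2 * \<bar>s\<bar> * B) * (\<xi>\<^sup>2 + r\<^sup>2) powr e" by (simp add: algebra_simps)
      \<comment> \<open>Since \<open>0 \<le> x < \<xi>\<close> and \<open>e \<le> 0\<close>, moving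
        from \<open>\<xi>\<close> back to \<open>x\<close> only increases the bound; the sign
        condition on the degree serves this step.\<close>
      also have "\<dots> \<le> (A + 2 * \<bar>s\<bar> * B) * (x\<^sup>2 + r\<^sup>2) powr e"
        using r x \<xi> e A(1) B(1)
        by (intro mult_left_mono powr_mono2') (auto intro!: add_nonneg_pos power_mono)
      finally show ?thesis .
    qed
    with A B show ?case unfolding e_def by (intro exI[of _ "A + 2 * \<bar>s\<bar> * B"]) auto
  qed
  with that show ?thesis by blast
qed

section \<open>Euler's transformation of a power series\<close>

definition euler_sum :: "nat \<Rightarrow> (real \<Rightarrow> real) \<Rightarrow> complex \<Rightarrow> complex" where
  "euler_sum M f z = (\<Sum>j<M. of_real ((fdiff ^^ j) f 0) * z ^ j / (1 - z) ^ Suc j)"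

text \<open>Multiplying the series by \<open>1 - z\<close> and collecting powers of \<open>z\<close>
  leaves \<open>f 0\<close> plus \<open>z\<close> times the series of differences. Convergence
  enters through summability alone, so boundary points \<open>z \<noteq> 1\<close> are
  covered.\<close>

lemma summation_by_parts:
  fixes z :: complex
  assumes "summable (\<lambda>n. of_real (f (real n)) * z ^ n)" and "z \<noteq> 1"
  shows "summable (\<lambda>n. of_real (fdiff f (real n)) * z ^ n)"
    and "(\<Sum>n. of_real (f (real n)) * z ^ n) =
           of_real (f 0) / (1 - z) + z / (1 - z) * (\<Sum>n. of_real (fdiff f (real n)) * z ^ n)"
proof -
  let ?a = "\<lambda>n. of_real (f (real n)) * z ^ n"
  have sum_Suc: "summable (\<lambda>n. ?a (Suc n))"
    using assms(1) by (subst summable_Suc_iff)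
  have eq: "z * (of_real (fdiff f (real n)) * z ^ n) = ?a (Suc n) - z * ?a n" for n
    by (simp add: fdiff_def algebra_simps)
  have "summable (\<lambda>n. z * (of_real (fdiff f (real n)) * z ^ n))"
    unfolding eq using sum_Suc assms(1) by (intro summable_diff summable_mult)
  \<comment> \<open>Cancelling the factor \<open>z\<close> requires \<open>z \<noteq> 0\<close>; at
    \<open>z = 0\<close> all terms with \<open>n > 0\<close> vanish.\<close>
  then show *: "summable (\<lambda>n. of_real (fdiff f (real n)) * z ^ n)"
    by (cases "z = 0") (simp_all add: summable_mult_D)
  have "z * (\<Sum>n. of_real (fdiff f (real n)) * z ^ n) = (\<Sum>n. ?a (Suc n)) - z * (\<Sum>n. ?a n)"
    unfolding suminf_mult[OF *, symmetric] suminf_mult[OF assms(1), symmetric] eq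
    using sum_Suc assms(1) by (intro suminf_diff [symmetric] summable_mult)
  also have "(\<Sum>n. ?a (Suc n)) = (\<Sum>n. ?a n) - of_real (f 0)"
    using suminf_split_head[OF assms(1)] by simp
  finally show "(\<Sum>n. of_real (f (real n)) * z ^ n) =
           of_real (f 0) / (1 - z) + z / (1 - z) * (\<Sum>n. of_real (fdiff f (real n)) * z ^ n)"
    using assms(2) by (simp add: divide_simps) (simp add: algebra_simps)
qed

lemma euler_transform:
  fixes z :: complex
  assumes "summable (\<lambda>n. of_real (f (real n)) * z ^ n)" and "z \<noteq> 1"
  shows "summable (\<lambda>n. of_real ((fdiff ^^ M) f (real n)) * z ^ n)"
    and "(\<Sum>n. of_real (f (real n)) * z ^ n) =
           euler_sum M f z + (z / (1 - z)) ^ M * (\<Sum>n. of_real ((fdiff ^^ M) f (real n)) * z ^ n)"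
proof (induction M)
  case (Suc M)
  { case 1 show ?case using summation_by_parts(1)[OF Suc.IH(1) assms(2)] by simp }
  { case 2 show ?case 
     unfolding Suc.IH(2) summation_by_parts(2)[OF Suc.IH(1) assms(2)]
     by (simp add: euler_sum_def algebra_simps power_divide) }
qed (use assms in \<open>simp_all add: euler_sum_def\<close>)

section \<open>Polylogarithms of negative odd order\<close>

lemma polylog_eq_euler_sum:
  assumes z: "z \<in> slit_plane" and M: "2 * k + 1 < M"
  shows "polylog (- 2 * of_nat k - 1) z = euler_sum M (\<lambda>x. x ^ (2 * k + 1)) z"
proof (rule polylog_eqI)
  show "euler_sum M (\<lambda>x. x ^ (2 * k + 1)) holomorphic_on slit_plane"
    unfolding euler_sum_def[abs_def]
    by (intro holomorphic_intros) (auto simp: slit_plane_def)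
next
  fix x :: complex assume x: "norm x < 1"
  let ?g = "\<lambda>n. of_real (real n ^ (2 * k + 1)) * x ^ n"
  have "(\<lambda>n. norm (of_real (real n ^ (2 * k + 1)) :: complex) / norm (of_real (real (Suc n) ^ (2 * k + 1)) :: complex))
          \<longlonglongrightarrow> 1 ^ (2 * k + 1)"
    using tendsto_power[OF LIMSEQ_n_over_Suc_n, of "2 * k + 1"]
    by (simp add: norm_power power_divide del: of_nat_Suc power_Suc)
  hence "conv_radius (\<lambda>n. of_real (real n ^ (2 * k + 1)) :: complex) = 1"
    by (intro conv_radius_ratio_limit_nonzero[of _ 1]) auto
  hence summ: "summable ?g"
    using x by (intro summable_in_conv_radius) simp
  have "x \<noteq> 1" using x by auto
  then have "?g sums euler_sum M (\<lambda>x. x ^ (2 * k + 1)) x"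
    using euler_transform(2)[OF summ, of M] summable_sums[OF summ] fdiff_pow_power_eq_0[OF M] by simp
  \<comment> \<open>The term \<open>n = 0\<close> is \<open>0 ^ (2 * k + 1) = 0\<close>, so the
    series may start at 1, as that of the polylogarithm does.\<close>
  hence "(\<lambda>n. ?g (Suc n)) sums euler_sum M (\<lambda>x. x ^ (2 * k + 1)) x"
    by (subst sums_Suc_iff) simp
  also have "(\<lambda>n. ?g (Suc n)) = (\<lambda>n. x ^ Suc n / of_nat (Suc n) powr (- 2 * of_nat k - 1))"
  proof
    fix n
    have "- 2 * of_nat k - 1 = (- of_nat (2 * k + 1) :: complex)" by simp
    then have "of_nat (Suc n) powr (- 2 * of_nat k - 1) = (of_nat (Suc n) :: complex) powr - of_nat (2 * k + 1)"
      by (simp only:)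
    also have "\<dots> = inverse (of_nat (Suc n) ^ (2 * k + 1))"
      by (subst powr_minus, subst powr_nat) auto
    finally show "?g (Suc n) = x ^ Suc n / of_nat (Suc n) powr (- 2 * of_nat k - 1)"
      by (simp add: field_simps del: of_nat_Suc)
  qed
  finally show "(\<lambda>n. x ^ Suc n / of_nat (Suc n) powr (- 2 * of_nat k - 1)) sums euler_sum M (\<lambda>x. x ^ (2 * k + 1)) x" .
qed (rule z)

section \<open>Binomial coefficients and asymptotics of the finite Euler sum\<close>

text \<open>The second identity follows from the first by negating the upper index; it turns the
  Taylor coefficients of \<open>(1 + y) powr (- \<mu> - 1)\<close> into those of the
  expansion.\<close>

lemma gbinomial_neg_eq_Gamma:
  fixes \<mu> :: real
  assumes "\<mu> > 0"
  shows "(real k + \<mu>) gchoose k = Gamma (real k + \<mu> + 1) / (fact k * Gamma (\<mu> + 1))"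
    and "(- \<mu> - 1) gchoose k = (-1) ^ k * Gamma (real k + \<mu> + 1) / (fact k * Gamma (\<mu> + 1))"
proof -
  show *: "(real k + \<mu>) gchoose k = Gamma (real k + \<mu> + 1) / (fact k * Gamma (\<mu> + 1))"
    using assms by (subst gbinomial_Gamma) (auto simp: algebra_simps elim!: nonpos_Ints_cases)
  have "(- (\<mu> + 1)) gchoose k = (-1) ^ k * ((real k + \<mu>) gchoose k)"
    by (subst gbinomial_minus) (simp add: algebra_simps)
  moreover have "- (\<mu> + 1) = - \<mu> - 1" by simp
  ultimately show "(- \<mu> - 1) gchoose k = (-1) ^ k * Gamma (real k + \<mu> + 1) / (fact k * Gamma (\<mu> + 1))"
    unfolding * by simp
qed

lemma euler_sum_diff: "euler_sum M (\<lambda>x. f x - g x) z = euler_sum M f z - euler_sum M g z"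
  by (simp add: euler_sum_def fdiff_pow_diff sum_subtractf left_diff_distrib diff_divide_distrib)

lemma euler_sum_lincomb:
  "euler_sum M (\<lambda>x. \<Sum>k<(K::nat). c k * f k x) z = (\<Sum>k<K. of_real (c k) * euler_sum M (f k) z)"
proof -
  have "(fdiff ^^ j) (\<lambda>x. \<Sum>k<K. c k * f k x) 0 = (\<Sum>k<K. c k * (fdiff ^^ j) (f k) 0)" for j
    by (subst fdiff_pow_sum) (simp_all add: fdiff_pow_cmult)
  then have "euler_sum M (\<lambda>x. \<Sum>k<K. c k * f k x) z = 
          (\<Sum>j<M. \<Sum>k<K. of_real (c k) * (of_real ((fdiff ^^ j) (f k) 0) * z ^ j / (1 - z) ^ Suc j))"
    by (simp add: euler_sum_def sum_distrib_right sum_divide_distrib mult.assoc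
          del: power_Suc)
  also have "\<dots> = (\<Sum>k<K. of_real (c k) * euler_sum M (f k) z)"
    by (subst sum.swap) (simp add: euler_sum_def sum_distrib_left)
  finally show ?thesis .
qed

text \<open>A difference combines only finitely many values of \<open>f r\<close>, so bounds whose
  constants depend on the point suffice.\<close>

lemma fdiff_pow_bigo:
  assumes "\<And>x. (\<lambda>r. f r x) \<in> O[G](g)"
  shows "(\<lambda>r. (fdiff ^^ j) (f r) x) \<in> O[G](g)"
  by (induction j arbitrary: x) (use assms in \<open>auto simp: fdiff_def intro: sum_in_bigo\<close>)

lemma euler_sum_bigo:
  assumes "\<And>x. (\<lambda>r. f r x) \<in> O[G](g)"
  shows "(\<lambda>r. euler_sum M (f r) z) \<in> O[G](\<lambda>r. of_real (g r))"
  unfolding euler_sum_def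
proof (intro big_sum_in_bigo)
  fix j
  have "(\<lambda>r. of_real ((fdiff ^^ j) (f r) 0) :: complex) \<in> O[G](\<lambda>r. of_real (g r))"
    using fdiff_pow_bigo[where j = j and x = 0, OF assms]
    by (subst landau_o.big.norm_iff[symmetric]) simp
  then have "(\<lambda>r. c * of_real ((fdiff ^^ j) (f r) 0)) \<in> O[G](\<lambda>r. of_real (g r))" for c :: complex
    by (cases "c = 0") auto
  from this[of "z ^ j / (1 - z) ^ Suc j"]
  show "(\<lambda>r. of_real ((fdiff ^^ j) (f r) 0) * z ^ j / (1 - z) ^ Suc j) \<in> O[G](\<lambda>r. of_real (g r))"
    by (simp add: mult_ac)
qed

text \<open>From order \<open>K\<close> on, every term of the binomial series contains
  \<open>y ^ K\<close>; the remaining factors are dominated by their absolute values at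
  \<open>y = 1 / 2\<close>, which form the series \<open>h\<close>.\<close>

lemma gen_binomial_remainder:
  fixes a :: real
  obtains C where "\<And>y. \<bar>y\<bar> \<le> 1 / 2 \<Longrightarrow>
    \<bar>(1 + y) powr a - (\<Sum>k<K. (a gchoose k) * y ^ k)\<bar> \<le> C * \<bar>y\<bar> ^ K"
proof -
  define h where "h n = \<bar>a gchoose (n + K)\<bar> * (1 / 2) ^ n" for n
  have sums: "(\<lambda>n. (a gchoose n) * y ^ n) sums (1 + y) powr a" if "\<bar>y\<bar> < 1" for y
    using gen_binomial_real[OF that] .
  \<comment> \<open>Convergence at \<open>3 / 4\<close>, a point strictly between
    \<open>1 / 2\<close> and 1, forces absolute convergence at \<open>1 / 2\<close>.\<close>
  have "summable (\<lambda>n. norm ((a gchoose n) * (1 / 2) ^ n))"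
    by (rule powser_insidea[OF sums_summable[OF sums[of "3 / 4"]]]) auto
  then have "summable (\<lambda>n. norm (a gchoose n) * (1 / 2) ^ n)"
    by (simp add: abs_mult)
  then have h: "summable h"
    unfolding h_def using summable_powser_ignore_initial_segment[of "\<lambda>n. norm (a gchoose n)" K "1 / 2"]
    by simp
  have "\<bar>(1 + y) powr a - (\<Sum>k<K. (a gchoose k) * y ^ k)\<bar> \<le> suminf h * \<bar>y\<bar> ^ K"
    if y: "\<bar>y\<bar> \<le> 1 / 2" for y
  proof -
    have "(\<lambda>n. (a gchoose (n + K)) * y ^ (n + K)) sums ((1 + y) powr a - (\<Sum>k<K. (a gchoose k) * y ^ k))"
      using sums[of y] y by (subst sums_iff_shift) auto
    moreover have "(\<lambda>n. h n * \<bar>y\<bar> ^ K) sums (suminf h * \<bar>y\<bar> ^ K)"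
      using h by (intro sums_mult2 summable_sums)
    moreover have "\<bar>(a gchoose (n + K)) * y ^ (n + K)\<bar> \<le> h n * \<bar>y\<bar> ^ K" for n
      unfolding h_def power_add abs_mult power_abs mult.assoc
      using y by (intro mult_left_mono mult_right_mono power_mono) auto
    ultimately show ?thesis
      using norm_suminf_le[of "\<lambda>n. (a gchoose (n + K)) * y ^ (n + K)" "\<lambda>n. h n * \<bar>y\<bar> ^ K"]
      by (simp add: sums_iff)
  qed
  with that show ?thesis by blast
qed

text \<open>For fixed \<open>x\<close> put \<open>y = (x / r)\<^sup>2\<close>: then
  \<open>x\<^sup>2 + r\<^sup>2 = r\<^sup>2 * (1 + y)\<close>, and the binomial remainder
  \<open>y ^ K\<close> supplies the factor \<open>r powr (- 2 * real K)\<close>.\<close>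

lemma quad_monom_remainder_bigo:
  "(\<lambda>r. quad_monom 1 s r x - (\<Sum>k<K. (s gchoose k) * r powr (2 * s - 2 * real k) * x ^ (2 * k + 1)))
     \<in> O(\<lambda>r. r powr (2 * s - 2 * real K))"
proof -
  obtain C where C: "\<And>y. \<bar>y\<bar> \<le> 1 / 2 \<Longrightarrow>
    \<bar>(1 + y) powr s - (\<Sum>k<K. (s gchoose k) * y ^ k)\<bar> \<le> C * \<bar>y\<bar> ^ K"
    using gen_binomial_remainder[of s K] by blast
  show ?thesis
  \<comment> \<open>The threshold \<open>2 * \<bar>x\<bar>\<close> brings \<open>y\<close> into the
    range of the remainder estimate; \<open>\<bar>x\<bar> ^ (2 * K)\<close> is the numerator of
    \<open>y ^ K\<close>.\<close>
  proof (rule bigoI[where c = "\<bar>x\<bar> * C * \<bar>x\<bar> ^ (2 * K)"], 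
         use eventually_ge_at_top[of "max 1 (2 * \<bar>x\<bar>)"] in eventually_elim)
    case (elim r)
    define y where "y = (x / r)\<^sup>2"
    have r: "r > 0" using elim by simp
    have "\<bar>x / r\<bar> \<le> 1 / 2" using elim r by (simp add: field_simps)
    then have "\<bar>x / r\<bar>\<^sup>2 \<le> (1 / 2)\<^sup>2" by (intro power_mono) auto
    then have "y \<le> (1 / 2)\<^sup>2" by (simp only: power2_abs y_def)
    moreover have "y \<ge> 0" by (simp add: y_def)
    ultimately have y: "\<bar>y\<bar> \<le> 1 / 2" by (simp add: power2_eq_square)
    have rk: "r powr (2 * s - 2 * real k) * x ^ (2 * k) = r powr (2 * s) * y ^ k" for k
    proof -
      have "r powr (2 * real k) = r ^ (2 * k)" using powr_realpow[OF r, of "2 * k"] by simp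
      then show ?thesis using r by (simp add: powr_diff y_def power_divide power_mult)
    qed
    have "x\<^sup>2 + r\<^sup>2 = r\<^sup>2 * (1 + y)" using r by (simp add: y_def field_simps)
    then have "(x\<^sup>2 + r\<^sup>2) powr s = (r\<^sup>2) powr s * (1 + y) powr s"
      by (simp add: powr_mult y_def)
    also have "(r\<^sup>2) powr s = r powr (2 * s)"
      using r by (simp add: powr_powr flip: powr_numeral)
    finally have eq: "quad_monom 1 s r x - (\<Sum>k<K. (s gchoose k) * r powr (2 * s - 2 * real k) * x ^ (2 * k + 1))
        = x * r powr (2 * s) * ((1 + y) powr s - (\<Sum>k<K. (s gchoose k) * y ^ k))"
      using rk by (simp add: quad_monom_def sum_distrib_left right_diff_distrib mult.assoc mult.left_commute)
    have "norm (x * r powr (2 * s) * ((1 + y) powr s - (\<Sum>k<K. (s gchoose k) * y ^ k))) \<le> 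
             \<bar>x\<bar> * r powr (2 * s) * (C * \<bar>y\<bar> ^ K)"
      unfolding real_norm_def abs_mult using C[OF y] by (intro mult_mono) auto
    also have "\<dots> = \<bar>x\<bar> * C * (r powr (2 * s) * y ^ K)" by (simp add: y_def)
    also have "\<dots> = \<bar>x\<bar> * C * \<bar>x\<bar> ^ (2 * K) * norm (r powr (2 * s - 2 * real K))"
      by (simp add: rk [symmetric] power_mult)
    finally show ?case unfolding eq .
  qed
qed

section \<open>The tail of the transformation\<close>

lemma fdiff_tail_bigo:
  fixes z :: complex
  assumes "s \<le> -1/2" and "norm z \<le> 1"
  shows "(\<lambda>r. \<Sum>n. of_real ((fdiff ^^ (2 * K + 3)) (quad_monom 1 s r) (real n)) * z ^ n)
           \<in> O(\<lambda>r. of_real (r powr (2 * s - 2 * real K)))"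
proof -
  define M where "M = 2 * K + 3"
  define e where "e = s - real K"
  \<comment> \<open>The exponent splits into \<open>e\<close>, which yields the power of
    \<open>r\<close>, and \<open>-1\<close>, which yields convergence in \<open>n\<close>.\<close>
  have e: "(real 1 + 2 * s - real M) / 2 = e - 1" by (simp add: M_def e_def field_simps)
  obtain C where C: "C \<ge> 0" "\<And>r x. r > 0 \<Longrightarrow> x \<ge> 0 \<Longrightarrow>
       \<bar>(fdiff ^^ M) (quad_monom 1 s r) x\<bar> \<le> C * (x\<^sup>2 + r\<^sup>2) powr (e - 1)"
    using fdiff_pow_quad_monom_bound[of 1 s M] assms(1) unfolding e by auto
  define g :: "nat \<Rightarrow> real" where "g n = 1 / ((real n)\<^sup>2 + 1)" for n
  have g: "summable g"
  proof (rule summable_comparison_test_ev)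
    show "eventually (\<lambda>n. norm (g n) \<le> inverse (real n ^ 2)) at_top"
      using eventually_gt_at_top[of 0]
    proof eventually_elim
      case (elim n)
      then have "1 / ((real n)\<^sup>2 + 1) \<le> 1 / (real n)\<^sup>2" by (intro divide_left_mono) (auto intro!: mult_pos_pos add_nonneg_pos)
      then show ?case by (simp add: g_def inverse_eq_divide)
    qed
  qed (rule inverse_power_summable, simp)
  show ?thesis
  proof (rule bigoI[where c = "C * suminf g"], use eventually_ge_at_top[of 1] in eventually_elim)
    case (elim r)
    have le: "norm (of_real ((fdiff ^^ M) (quad_monom 1 s r) (real n)) * z ^ n)
               \<le> C * r powr (2 * e) * g n" for n
    proof -
      have pos: "(real n)\<^sup>2 + r\<^sup>2 > 0" using elim by (simp add: add_nonneg_pos)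
      have "norm (of_real ((fdiff ^^ M) (quad_monom 1 s r) (real n)) * z ^ n)
              \<le> C * ((real n)\<^sup>2 + r\<^sup>2) powr (e - 1) * 1"
        unfolding norm_mult norm_power norm_of_real using elim assms(2) C(1)
        by (intro mult_mono C power_le_one) auto
      also have "((real n)\<^sup>2 + r\<^sup>2) powr (e - 1) = ((real n)\<^sup>2 + r\<^sup>2) powr e * (1 / ((real n)\<^sup>2 + r\<^sup>2))"
        using pos by (simp add: powr_diff)
      \<comment> \<open>Because \<open>e \<le> 0\<close>, dropping \<open>n\<close> enlarges the
        first factor; because \<open>r \<ge> 1\<close>, replacing \<open>r\<close> by 1 enlarges the
        second.\<close>
      also have "\<dots> \<le> (r\<^sup>2) powr e * g n"
        unfolding g_def using elim assms(1)
        by (intro mult_mono powr_mono2' divide_left_mono mult_pos_pos add_nonneg_pos) (auto simp: e_def)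
      also have "(r\<^sup>2) powr e = r powr (2 * e)"
        using elim by (simp add: powr_powr flip: powr_numeral)
      finally show ?thesis using C(1) by (simp add: mult_left_mono mult.assoc)
    qed
    have "norm (\<Sum>n. of_real ((fdiff ^^ M) (quad_monom 1 s r) (real n)) * z ^ n)
            \<le> (\<Sum>n. C * r powr (2 * e) * g n)"
      using g by (intro norm_suminf_le le summable_mult)
    also have "\<dots> = C * suminf g * norm (of_real (r powr (2 * e)) :: complex)"
      using g by (subst suminf_mult) auto
    finally show ?case by (simp add: e_def M_def algebra_simps)
  qed
qed

section \<open>The series \<open>F_sum\<close> and its expansion\<close>

text \<open>The factor \<open>x\<close> in \<open>quad_monom 1\<close> kills the term
  \<open>n = 0\<close>, so the sum may start at 0 as Euler's transformation requires. Comparison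
  with \<open>n powr (- 2 * \<mu> - 1)\<close> gives absolute convergence on the whole closed
  disc.\<close>

lemma F_sum_eq:
  assumes "\<mu> > 0" "r > 0" "norm z \<le> 1"
  shows "summable (\<lambda>n. of_real (quad_monom 1 (- \<mu> - 1) r (real n)) * z ^ n)"
    and "F_sum \<mu> r z = 2 * (\<Sum>n. of_real (quad_monom 1 (- \<mu> - 1) r (real n)) * z ^ n)"
proof -
  let ?a = "\<lambda>n. of_real (quad_monom 1 (- \<mu> - 1) r (real n)) * z ^ n"
  show summ: "summable ?a"
  proof (rule summable_comparison_test_ev)
    show "eventually (\<lambda>n. norm (?a n) \<le> real n powr (- 2 * \<mu> - 1)) at_top"
      using eventually_gt_at_top[of 0]
    proof eventually_elim
      case (elim n)
      have "norm (?a n) \<le> \<bar>quad_monom 1 (- \<mu> - 1) r (real n)\<bar> * 1"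
        unfolding norm_mult norm_power norm_of_real
        using assms by (intro mult_left_mono power_le_one) auto
      also have "\<dots> \<le> ((real n)\<^sup>2 + r\<^sup>2) powr ((real 1 + 2 * (- \<mu> - 1)) / 2)"
        using abs_quad_monom_le[OF assms(2), of 1 "- \<mu> - 1" "real n"] by simp
      also have "\<dots> \<le> ((real n)\<^sup>2) powr ((real 1 + 2 * (- \<mu> - 1)) / 2)"
        using elim assms by (intro powr_mono2') auto
      also have "\<dots> = real n powr (2 * ((real 1 + 2 * (- \<mu> - 1)) / 2))"
        using elim by (simp only: powr_powr of_nat_0_less_iff flip: powr_numeral)
      also have "2 * ((real 1 + 2 * (- \<mu> - 1)) / 2) = - 2 * \<mu> - 1" by simp
      finally show ?case .
    qed
    show "summable (\<lambda>n. real n powr (- 2 * \<mu> - 1))"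
      using assms by (simp add: summable_real_powr_iff)
  qed
  have sum_Suc: "summable (\<lambda>n. ?a (Suc n))" using summ by (subst summable_Suc_iff)
  have "F_sum \<mu> r z = (\<Sum>n. 2 * ?a (Suc n))"
    unfolding F_sum_def quad_monom_def
    by (intro suminf_cong) (simp add: powr_diff powr_minus powr_add field_simps)
  also have "\<dots> = 2 * (\<Sum>n. ?a (Suc n))" using sum_Suc by (rule suminf_mult)
  also have "(\<Sum>n. ?a (Suc n)) = suminf ?a"
    using suminf_split_head[OF summ] by (simp add: quad_monom_def)
  finally show "F_sum \<mu> r z = 2 * suminf ?a" .
qed

theorem theorem2p1:
  fixes \<mu> :: real and z :: complex
  assumes "\<mu> > 0" and "norm z \<le> 1" and "z \<noteq> 1"
  shows "has_asymptotic_expansion (\<lambda>r. F_sum \<mu> r z)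
           (\<lambda>k r. of_real (r powr (- 2 * real k - 2 * \<mu> - 2)
                    * (2 * (-1) ^ k * Gamma (real k + \<mu> + 1) / (fact k * Gamma (\<mu> + 1))))
                  * polylog (- 2 * of_nat k - 1) z)
           (\<lambda>K r. r powr (- 2 * real K - 2 * \<mu> - 2)) at_top
       \<and> (\<forall>k. \<forall>r>0.
            of_real (r powr (- 2 * real k - 2 * \<mu> - 2)
              * (2 * (-1) ^ k * Gamma (real k + \<mu> + 1) / (fact k * Gamma (\<mu> + 1))))
              * polylog (- 2 * of_nat k - 1) z
            = 2 * (of_real (r powr (- 2 * real k - 2 * \<mu> - 2)
                     * (-1) ^ k * ((real k + \<mu>) gchoose k))
                   * polylog (- 2 * of_nat k - 1) z))"
proof (intro conjI allI impI)
  define s where "s = - \<mu> - 1"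
  have exp_eq: "- 2 * real k - 2 * \<mu> - 2 = 2 * s - 2 * real k" for k by (simp add: s_def)
  \<comment> \<open>The closed unit disc meets the cut only at 1.\<close>
  have z: "z \<in> slit_plane"
    using assms(2,3) by (auto simp: slit_plane_def)
  show "has_asymptotic_expansion (\<lambda>r. F_sum \<mu> r z)
           (\<lambda>k r. of_real (r powr (- 2 * real k - 2 * \<mu> - 2)
                    * (2 * (-1) ^ k * Gamma (real k + \<mu> + 1) / (fact k * Gamma (\<mu> + 1))))
                  * polylog (- 2 * of_nat k - 1) z)
           (\<lambda>K r. r powr (- 2 * real K - 2 * \<mu> - 2)) at_top"
    unfolding has_asymptotic_expansion_def exp_eq
  proof
    fix K :: nat
    \<comment> \<open>\<open>2 * K\<close> differences annihilate the Taylor polynomial \<open>P r\<close>; the further three leave a factor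
      \<open>(n\<^sup>2 + r\<^sup>2) powr (-1)\<close> with which the tail can be summed over \<open>n\<close>.\<close>
    define M where "M = 2 * K + 3"
    define P where "P r x = (\<Sum>k<K. (s gchoose k) * r powr (2 * s - 2 * real k) * x ^ (2 * k + 1))"
      for r x :: real
    define T where "T r = (\<Sum>n. of_real ((fdiff ^^ M) (quad_monom 1 s r) (real n)) * z ^ n)" for r
    define E where "E r = euler_sum M (\<lambda>x. quad_monom 1 s r x - P r x) z" for r
    let ?t = "\<lambda>k r. of_real (r powr (2 * s - 2 * real k)
        * (2 * (-1) ^ k * Gamma (real k + \<mu> + 1) / (fact k * Gamma (\<mu> + 1))))
        * polylog (- 2 * of_nat k - 1) z"
    let ?O = "O(\<lambda>r. complex_of_real (r powr (2 * s - 2 * real K)))"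
    \<comment> \<open>As \<open>2 * k + 1 < M\<close> for all \<open>k < K\<close>, a single
      \<open>M\<close> turns every polylogarithm into an Euler sum, and linearity assembles these
      into that of \<open>P r\<close>.\<close>
    have "(\<Sum>k<K. ?t k r) = 2 * euler_sum M (P r) z" for r
    proof -
      have "?t k r = 2 * (of_real ((s gchoose k) * r powr (2 * s - 2 * real k))
                          * euler_sum M (\<lambda>x. x ^ (2 * k + 1)) z)" if "k < K" for k
        using that assms(1) unfolding s_def
        by (subst polylog_eq_euler_sum[OF z, of k M]) (simp_all add: M_def gbinomial_neg_eq_Gamma)
      then show ?thesis
        unfolding P_def euler_sum_lincomb by (simp add: sum_distrib_left)
    qed
    moreover have "F_sum \<mu> r z = 2 * (euler_sum M (quad_monom 1 s r) z + (z / (1 - z)) ^ M * T r)" 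
      if "r > 0" for r
      using F_sum_eq[OF assms(1) that assms(2)] euler_transform(2)[OF _ assms(3)]
      unfolding T_def s_def by simp
    \<comment> \<open>Linearity merges the two finite sums into \<open>E r\<close>, the Euler sum of
      the pointwise binomial remainder.\<close>
    ultimately have eq: "F_sum \<mu> r z - (\<Sum>k<K. ?t k r) = 2 * (E r + (z / (1 - z)) ^ M * T r)"
      if "r > 0" for r
      using that by (simp add: E_def euler_sum_diff algebra_simps)
    have "E \<in> ?O"
      unfolding E_def[abs_def] P_def by (intro euler_sum_bigo quad_monom_remainder_bigo)
    moreover have "T \<in> ?O"
      unfolding T_def[abs_def] M_def using assms by (intro fdiff_tail_bigo) (auto simp: s_def)
    ultimately have "(\<lambda>r. 2 * (E r + (z / (1 - z)) ^ M * T r)) \<in> ?O"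
      by (auto intro!: sum_in_bigo)
    moreover have "eventually (\<lambda>r. F_sum \<mu> r z - (\<Sum>k<K. ?t k r) = 2 * (E r + (z / (1 - z)) ^ M * T r)) at_top"
      using eventually_gt_at_top[of 0] by eventually_elim (rule eq)
    ultimately show "(\<lambda>r. F_sum \<mu> r z - (\<Sum>k<K. ?t k r)) \<in> ?O"
      by (subst landau_o.big.in_cong)
  qed
qed (use assms in \<open>simp add: gbinomial_neg_eq_Gamma\<close>)

end
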